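(* Let $A$ be a Noetherian integral domain with field of fractions $K$, let $M$ be a finitely generated torsion-free $A$-module, and put $V=K\otimes_A M$, assumed of dimension $n\ge 2$ over $K$. Let $G^*(M)$ be the poset, ordered by inclusion, of pure submodules $N\subseteq M$ with $N\neq 0$ and $N\neq M$. Let $\mathcal{S}^*(M)$ be the poset, ordered by inclusion, of nonempty finite subsets $Y\subseteq M\setminus\{0\}$ whose rank (the $K$-dimension of the subspace of $V$ spanned by $Y$) is $<n$. Then the order-preserving map \[\operatorname{AR}:\mathcal{S}^*(M)\to G^*(M),\qquad Y\mapsto \langle Y\rangle_{\mathrm{sat}},\] sending $Y$ to the saturation of the submodule generated by $Y$, is a homotopy equivalence, i.e. it induces a homotopy equivalence between the geometric realisations of the nerves of these posets (viewed as categories).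
   Context: A submodule $N\subseteq M$ is pure if $M/N$ is torsion-free. The saturation $P_{\mathrm{sat}}$ of a submodule $P\subseteq M$ is the smallest pure submodule of $M$ containing $P$, namely the kernel of $M\to M/P\to (M/P)/\text{torsion}$. Equivalently, $\mathcal{S}^*(M)$ is the poset of simplices of the simplicial complex $E^*(M)$ whose simplices are the nonempty finite subsets of $M\setminus\{0\}$ of rank $<n$. *)

theory Defs
  imports "HOL-Analysis.Analysis"
begin

definition noetherian_ring :: "'a::comm_ring_1 itself \<Rightarrow> bool" where
  "noetherian_ring _ \<longleftrightarrow>
     (\<forall>I::'a set. module.subspace ((*)) I \<longrightarrow> (\<exists>S. finite S \<and> I = module.span ((*)) S))"

definition fin_gen_module :: "('a::comm_ring_1 \<Rightarrow> 'm::ab_group_add \<Rightarrow> 'm) \<Rightarrow> bool" where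
  "fin_gen_module sc \<longleftrightarrow> (\<exists>S. finite S \<and> module.span sc S = UNIV)"

definition torsion_free :: "('a::comm_ring_1 \<Rightarrow> 'm::ab_group_add \<Rightarrow> 'm) \<Rightarrow> bool" where
  "torsion_free sc \<longleftrightarrow> (\<forall>a m. sc a m = 0 \<longrightarrow> a = 0 \<or> m = 0)"

text \<open>Rank of a subset Y of a torsion-free module M over a domain A: the K-dimension
  of the subspace of V = K \<otimes> M spanned by Y.  Since M is torsion-free, M embeds
  in V and a family in M is K-linearly independent in V iff it is A-linearly
  independent in M (clear denominators); so the rank is the maximal size of an
  A-linearly independent subset of Y.\<close>
definition mod_rank :: "('a::comm_ring_1 \<Rightarrow> 'm::ab_group_add \<Rightarrow> 'm) \<Rightarrow> 'm set \<Rightarrow> nat" where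
  "mod_rank sc Y = Max {card Z | Z. Z \<subseteq> Y \<and> finite Z \<and> \<not> module.dependent sc Z}"

text \<open>N is pure iff M/N is torsion-free.\<close>
definition pure_submodule :: "('a::comm_ring_1 \<Rightarrow> 'm::ab_group_add \<Rightarrow> 'm) \<Rightarrow> 'm set \<Rightarrow> bool" where
  "pure_submodule sc N \<longleftrightarrow> module.subspace sc N \<and>
     (\<forall>a m. a \<noteq> 0 \<longrightarrow> sc a m \<in> N \<longrightarrow> m \<in> N)"

text \<open>Saturation: the kernel of M \<rightarrow> M/P \<rightarrow> (M/P)/torsion.\<close>
definition saturation :: "('a::comm_ring_1 \<Rightarrow> 'm::ab_group_add \<Rightarrow> 'm) \<Rightarrow> 'm set \<Rightarrow> 'm set" where
  "saturation sc P = {m. \<exists>a. a \<noteq> 0 \<and> sc a m \<in> P}"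

definition Gstar :: "('a::comm_ring_1 \<Rightarrow> 'm::ab_group_add \<Rightarrow> 'm) \<Rightarrow> 'm set set" where
  "Gstar sc = {N. pure_submodule sc N \<and> N \<noteq> {0} \<and> N \<noteq> UNIV}"

definition Sstar :: "('a::comm_ring_1 \<Rightarrow> 'm::ab_group_add \<Rightarrow> 'm) \<Rightarrow> 'm set set" where
  "Sstar sc = {Y. finite Y \<and> Y \<noteq> {} \<and> 0 \<notin> Y \<and> mod_rank sc Y < mod_rank sc UNIV}"

definition AR :: "('a::comm_ring_1 \<Rightarrow> 'm::ab_group_add \<Rightarrow> 'm) \<Rightarrow> 'm set \<Rightarrow> 'm set" where
  "AR sc Y = saturation sc (module.span sc Y)"

text \<open>Simplices of the nerve: nonempty finite chains of P w.r.t. the order le.\<close>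
definition poset_chains :: "'x set \<Rightarrow> ('x \<Rightarrow> 'x \<Rightarrow> bool) \<Rightarrow> 'x set set" where
  "poset_chains P le = {C. C \<subseteq> P \<and> finite C \<and> C \<noteq> {} \<and> (\<forall>x\<in>C. \<forall>y\<in>C. le x y \<or> le y x)}"

definition geom_simplex :: "'x set \<Rightarrow> ('x \<Rightarrow> real) set" where
  "geom_simplex C = {t. (\<forall>x. 0 \<le> t x) \<and> (\<forall>x. x \<notin> C \<longrightarrow> t x = 0) \<and> sum t C = 1}"

definition realisation_carrier :: "'x set \<Rightarrow> ('x \<Rightarrow> 'x \<Rightarrow> bool) \<Rightarrow> ('x \<Rightarrow> real) set" where
  "realisation_carrier P le = \<Union> (geom_simplex ` poset_chains P le)"

text \<open>The geometric realisation with the weak (coherent) topology: a set is open iff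
  its trace on each closed simplex is open in the Euclidean topology of that simplex.\<close>
definition realisation :: "'x set \<Rightarrow> ('x \<Rightarrow> 'x \<Rightarrow> bool) \<Rightarrow> ('x \<Rightarrow> real) topology" where
  "realisation P le = topology (\<lambda>U. U \<subseteq> realisation_carrier P le \<and>
     (\<forall>C\<in>poset_chains P le.
        openin (subtopology (powertop_real UNIV) (geom_simplex C)) (U \<inter> geom_simplex C)))"

text \<open>The map of realisations induced by a map of posets (affine on simplices).\<close>
definition realise_map :: "('x \<Rightarrow> 'y) \<Rightarrow> ('x \<Rightarrow> real) \<Rightarrow> ('y \<Rightarrow> real)" where
  "realise_map f t = (\<lambda>y. \<Sum>x\<in>{x. t x \<noteq> 0 \<and> f x = y}. t x)"

definition homotopy_equivalence_map ::
  "'p topology \<Rightarrow> 'q topology \<Rightarrow> ('p \<Rightarrow> 'q) \<Rightarrow> bool" where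
  "homotopy_equivalence_map X Y f \<longleftrightarrow> continuous_map X Y f \<and>
     (\<exists>g. continuous_map Y X g \<and> homotopic_with (\<lambda>_. True) X X (g \<circ> f) id \<and>
          homotopic_with (\<lambda>_. True) Y Y (f \<circ> g) id)"

end

theory Submission
  imports Defs
begin

text \<open>A simplicial complex is homeomorphic to its barycentric subdivision, with explicit mutually
  inverse maps \<open>bary\<close> and \<open>layers\<close>.  Choose for every pure submodule \<open>N\<close> a finite set \<open>B N\<close> of
  nonzero elements whose saturated span is \<open>N\<close>.  Sending a chain \<open>c\<close> of pure submodules to
  \<open>g c = (\<Union>N\<in>c. B N)\<close> is order preserving and satisfies \<open>AR (g c) = max c\<close>; preceded by the
  subdivision homeomorphism it gives a homotopy inverse \<open>h\<close> of \<open>AR\<close>.  Then \<open>AR \<circ> h\<close> preserves every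
  simplex, so it is homotopic to the identity by straight lines.  For \<open>h \<circ> AR\<close> the straight lines
  are available only in the undivided complex \<open>E\<^sup>*(M)\<close>: a flag with largest member \<open>Y\<close> and its image
  both lie in the simplex spanned by \<open>Y\<close> and finitely many further elements of \<open>AR Y\<close>.\<close>

section \<open>The coherent topology of a simplicial complex\<close>

definition coherent_carrier :: "'x set set \<Rightarrow> ('x \<Rightarrow> real) set" where
  "coherent_carrier \<Delta> = \<Union> (geom_simplex ` \<Delta>)"

text \<open>The family \<open>\<Delta>\<close> is arbitrary because two kinds of complex occur:
  nerves, where \<open>\<Delta>\<close> consists of chains, and the undivided complex, where
  \<open>\<Delta>\<close> is the family of finite sets itself.\<close>

definition coherent_topology :: "'x set set \<Rightarrow> ('x \<Rightarrow> real) topology" where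
  "coherent_topology \<Delta> = topology (\<lambda>U. U \<subseteq> coherent_carrier \<Delta> \<and>
     (\<forall>C\<in>\<Delta>. openin (subtopology (powertop_real UNIV) (geom_simplex C)) (U \<inter> geom_simplex C)))"

abbreviation simplex_top :: "'x set \<Rightarrow> ('x \<Rightarrow> real) topology" where
  "simplex_top C \<equiv> subtopology (powertop_real UNIV) (geom_simplex C)"

lemma realisation_eq_coherent: "realisation P le = coherent_topology (poset_chains P le)"
  by (simp add: realisation_def coherent_topology_def realisation_carrier_def coherent_carrier_def)

lemma openin_coherent:
  "openin (coherent_topology \<Delta>) U \<longleftrightarrow>
     U \<subseteq> coherent_carrier \<Delta> \<and> (\<forall>C\<in>\<Delta>. openin (simplex_top C) (U \<inter> geom_simplex C))"
proof -
  have "istopology (\<lambda>U. U \<subseteq> coherent_carrier \<Delta> \<and> (\<forall>C\<in>\<Delta>. openin (simplex_top C) (U \<inter> geom_simplex C)))"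
    unfolding istopology_def
  proof (intro conjI allI impI ballI)
    fix S T C assume "S \<subseteq> coherent_carrier \<Delta> \<and> (\<forall>C\<in>\<Delta>. openin (simplex_top C) (S \<inter> geom_simplex C))"
      "T \<subseteq> coherent_carrier \<Delta> \<and> (\<forall>C\<in>\<Delta>. openin (simplex_top C) (T \<inter> geom_simplex C))" "C \<in> \<Delta>"
    then have "openin (simplex_top C) ((S \<inter> geom_simplex C) \<inter> (T \<inter> geom_simplex C))"
      by blast
    then show "openin (simplex_top C) (S \<inter> T \<inter> geom_simplex C)"
      by (simp add: Int_ac)
  next
    fix \<K> C assume K: "\<forall>K\<in>\<K>. K \<subseteq> coherent_carrier \<Delta> \<and> (\<forall>C\<in>\<Delta>. openin (simplex_top C) (K \<inter> geom_simplex C))"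
      and "C \<in> \<Delta>"
    then have "openin (simplex_top C) (\<Union>K\<in>\<K>. K \<inter> geom_simplex C)"
      by blast
    then show "openin (simplex_top C) (\<Union> \<K> \<inter> geom_simplex C)"
      by (simp add: Int_commute Int_Union)
  qed blast+
  then show ?thesis
    by (simp add: coherent_topology_def)
qed

lemma topspace_simplex_top [simp]: "topspace (simplex_top C) = geom_simplex C"
  by (simp add: topspace_product_topology)

lemma topspace_coherent [simp]: "topspace (coherent_topology \<Delta>) = coherent_carrier \<Delta>"
proof -
  have "openin (simplex_top C) (coherent_carrier \<Delta> \<inter> geom_simplex C)" if "C \<in> \<Delta>" for C
  proof -
    have "coherent_carrier \<Delta> \<inter> geom_simplex C = geom_simplex C"
      using that by (auto simp: coherent_carrier_def)
    then show ?thesis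
      by (metis openin_topspace topspace_simplex_top)
  qed
  then have "openin (coherent_topology \<Delta>) (coherent_carrier \<Delta>)"
    by (simp add: openin_coherent)
  then show ?thesis
    by (metis openin_subset openin_topspace openin_coherent subset_antisym)
qed

lemma geom_simplex_subset_carrier: "C \<in> \<Delta> \<Longrightarrow> geom_simplex C \<subseteq> coherent_carrier \<Delta>"
  by (auto simp: coherent_carrier_def)

lemma geom_simplex_mono:
  assumes "C \<subseteq> D" "finite D"
  shows "geom_simplex C \<subseteq> geom_simplex D"
proof
  fix t assume t: "t \<in> geom_simplex C"
  have "sum t D = sum t C"
    using assms t by (intro sum.mono_neutral_right) (auto simp: geom_simplex_def)
  with t assms show "t \<in> geom_simplex D"
    by (auto simp: geom_simplex_def)
qed

text \<open>The coherent topology is the final topology for the inclusions of the closed simplices.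
  This is its universal property; it reduces continuity of a map out of a complex to one closed
  simplex at a time.\<close>

lemma continuous_map_coherent_iff:
  "continuous_map (coherent_topology \<Delta>) Y F \<longleftrightarrow> (\<forall>C\<in>\<Delta>. continuous_map (simplex_top C) Y F)"
proof
  assume F: "continuous_map (coherent_topology \<Delta>) Y F"
  show "\<forall>C\<in>\<Delta>. continuous_map (simplex_top C) Y F"
  proof
    fix C assume C: "C \<in> \<Delta>"
    have "continuous_map (simplex_top C) (coherent_topology \<Delta>) id"
      unfolding continuous_map_def
    proof (intro conjI allI impI)
      show "id \<in> topspace (simplex_top C) \<rightarrow> topspace (coherent_topology \<Delta>)"
        using geom_simplex_subset_carrier[OF C] by auto
      fix U assume "openin (coherent_topology \<Delta>) U"
      then have "openin (simplex_top C) (U \<inter> geom_simplex C)"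
        using C by (simp add: openin_coherent)
      moreover have "{x \<in> geom_simplex C. x \<in> U} = U \<inter> geom_simplex C"
        by blast
      ultimately show "openin (simplex_top C) {x \<in> topspace (simplex_top C). id x \<in> U}"
        by simp
    qed
    from continuous_map_compose[OF this F] show "continuous_map (simplex_top C) Y F"
      by simp
  qed
next
  assume F: "\<forall>C\<in>\<Delta>. continuous_map (simplex_top C) Y F"
  show "continuous_map (coherent_topology \<Delta>) Y F"
    unfolding continuous_map_def
  proof (intro conjI allI impI)
    show "F \<in> topspace (coherent_topology \<Delta>) \<rightarrow> topspace Y"
      using F by (fastforce simp: coherent_carrier_def dest: continuous_map_funspace)
    fix U assume U: "openin Y U"
    have "openin (simplex_top C) ({x \<in> coherent_carrier \<Delta>. F x \<in> U} \<inter> geom_simplex C)" if C: "C \<in> \<Delta>" for C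
    proof -
      have "{x \<in> coherent_carrier \<Delta>. F x \<in> U} \<inter> geom_simplex C = {x \<in> topspace (simplex_top C). F x \<in> U}"
        using C geom_simplex_subset_carrier[OF C] by auto
      then show ?thesis
        using openin_continuous_map_preimage[OF bspec[OF F C] U] by (simp only:)
    qed
    then show "openin (coherent_topology \<Delta>) {x \<in> topspace (coherent_topology \<Delta>). F x \<in> U}"
      by (auto simp: openin_coherent)
  qed
qed

lemma continuous_map_coordinate [continuous_intros]:
  "continuous_map (simplex_top C) euclideanreal (\<lambda>t. t x)"
  by (intro continuous_map_from_subtopology continuous_map_product_projection) auto

text \<open>The coherent topology is finer than the product topology, so a continuous map into a
  complex has continuous coordinates.\<close>

lemma continuous_map_coherent_powertop: "continuous_map (coherent_topology \<Delta>) (powertop_real UNIV) id"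
  unfolding continuous_map_coherent_iff
  by (simp add: continuous_map_from_subtopology)

text \<open>The simplex is cut out by closed conditions on single coordinates and on one finite sum
  of coordinates.\<close>

lemma closedin_geom_simplex:
  assumes "finite C"
  shows "closedin (powertop_real UNIV) (geom_simplex C)"
proof -
  let ?X = "powertop_real (UNIV :: 'a set)"
  have co: "continuous_map ?X euclideanreal (\<lambda>t. t x)" for x
    by (intro continuous_map_product_projection) auto
  have 1: "closedin ?X {t \<in> topspace ?X. t x \<in> {0..}}" for x
    by (rule closedin_continuous_map_preimage[OF co]) (metis closed_atLeast closed_closedin)
  have 2: "closedin ?X {t \<in> topspace ?X. t x \<in> {0}}" for x
    by (rule closedin_continuous_map_preimage[OF co]) auto
  have 3: "closedin ?X {t \<in> topspace ?X. sum t C \<in> {1}}"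
    by (rule closedin_continuous_map_preimage[OF continuous_map_sum[OF assms co]]) auto
  have "geom_simplex C = \<Inter> ((\<lambda>x. {t \<in> topspace ?X. t x \<in> {0..}}) ` UNIV
      \<union> (\<lambda>x. {t \<in> topspace ?X. t x \<in> {0}}) ` (-C) \<union> {{t \<in> topspace ?X. sum t C \<in> {1}}})"
    by (auto simp: geom_simplex_def topspace_product_topology)
  moreover have "closedin ?X \<dots>"
    using 1 2 3 by (intro closedin_Inter) auto
  ultimately show ?thesis by simp
qed

text \<open>A finite subcomplex carries the product topology, because the simplices are closed there.\<close>
lemma continuous_map_into_coherent:
  assumes F: "continuous_map X (powertop_real UNIV) F"
    and \<Gamma>: "finite \<Gamma>" "\<Gamma> \<subseteq> \<Delta>" "\<And>C. C \<in> \<Gamma> \<Longrightarrow> finite C"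
    and im: "F \<in> topspace X \<rightarrow> \<Union> (geom_simplex ` \<Gamma>)"
  shows "continuous_map X (coherent_topology \<Delta>) F"
  unfolding continuous_map_closedin
proof (intro conjI allI impI)
  show "F \<in> topspace X \<rightarrow> topspace (coherent_topology \<Delta>)"
  proof -
    have "\<Union> (geom_simplex ` \<Gamma>) \<subseteq> coherent_carrier \<Delta>"
      using \<Gamma>(2) by (auto simp: coherent_carrier_def)
    with im show ?thesis
      by (auto simp: Pi_iff)
  qed
  fix A assume A: "closedin (coherent_topology \<Delta>) A"
  \<comment> \<open>Closed rather than open sets are pulled back: a set closed in a closed simplex
    is closed in the full product, and a finite union of such sets stays closed.\<close>
  have "closedin (powertop_real UNIV) (A \<inter> geom_simplex C)" if "C \<in> \<Gamma>" for C
  proof -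
    have "openin (simplex_top C) ((coherent_carrier \<Delta> - A) \<inter> geom_simplex C)"
      using A that \<Gamma> by (auto simp: closedin_def openin_coherent)
    moreover have "(coherent_carrier \<Delta> - A) \<inter> geom_simplex C = topspace (simplex_top C) - A \<inter> geom_simplex C"
      using that \<Gamma> geom_simplex_subset_carrier[of C \<Delta>] by auto
    ultimately have "closedin (simplex_top C) (A \<inter> geom_simplex C)"
      by (auto simp: closedin_def)
    then show ?thesis
      using closedin_geom_simplex[of C] that \<Gamma> by (meson closedin_trans_full)
  qed
  then have "closedin (powertop_real UNIV) (\<Union>C\<in>\<Gamma>. A \<inter> geom_simplex C)"
    using \<Gamma> by (intro closedin_Union) auto
  from closedin_continuous_map_preimage[OF F this]
  have "closedin X {x \<in> topspace X. F x \<in> (\<Union>C\<in>\<Gamma>. A \<inter> geom_simplex C)}" .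
  moreover have "{x \<in> topspace X. F x \<in> (\<Union>C\<in>\<Gamma>. A \<inter> geom_simplex C)} = {x \<in> topspace X. F x \<in> A}"
    using im by auto
  ultimately show "closedin X {x \<in> topspace X. F x \<in> A}"
    by simp
qed

lemma continuous_map_into_coherent_simplex:
  assumes "continuous_map X (powertop_real UNIV) F" "finite C" "C \<in> \<Delta>"
    and "F \<in> topspace X \<rightarrow> geom_simplex C"
  shows "continuous_map X (coherent_topology \<Delta>) F"
  using assms by (intro continuous_map_into_coherent[where \<Gamma> = "{C}"]) auto

text \<open>By the tube lemma, in every closed simplex the set of
  points whose whole fibre over a compact interval is mapped into an open set is relatively open.\<close>
lemma continuous_map_prod_coherent:
  assumes H: "\<And>C. C \<in> \<Delta> \<Longrightarrow> continuous_map (prod_topology (top_of_set {0..1::real}) (simplex_top C)) Y H"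
  shows "continuous_map (prod_topology (top_of_set {0..1::real}) (coherent_topology \<Delta>)) Y H"
proof -
  have fs: "H \<in> {0..1} \<times> coherent_carrier \<Delta> \<rightarrow> topspace Y"
    using H by (fastforce simp: coherent_carrier_def dest!: continuous_map_funspace)
  show ?thesis
    unfolding continuous_map_def
  proof (intro conjI allI impI)
    show "H \<in> topspace (prod_topology (top_of_set {0..1}) (coherent_topology \<Delta>)) \<rightarrow> topspace Y"
      using fs by simp
    fix W assume W: "openin Y W"
    have "\<exists>J U. openin (top_of_set {0..1}) J \<and> openin (coherent_topology \<Delta>) U \<and> \<tau> \<in> J \<and> s \<in> U \<and>
        J \<times> U \<subseteq> {z \<in> {0..1} \<times> coherent_carrier \<Delta>. H z \<in> W}"
      if ts: "\<tau> \<in> {0..1}" "s \<in> coherent_carrier \<Delta>" "H (\<tau>, s) \<in> W" for \<tau> s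
    proof -
      obtain C where C: "C \<in> \<Delta>" "s \<in> geom_simplex C"
        using ts by (auto simp: coherent_carrier_def)
      have "continuous_map (top_of_set {0..1}) Y (H \<circ> (\<lambda>\<tau>. (\<tau>, s)))"
        using C by (intro continuous_map_compose[OF _ H[OF C(1)]]) (auto simp: continuous_map_pairwise o_def)
      then have "openin (top_of_set {0..1}) {\<tau> \<in> {0..1}. H (\<tau>, s) \<in> W}"
        using openin_continuous_map_preimage[OF _ W] by fastforce
      then obtain e where e: "e > 0" "\<And>\<sigma>. \<sigma> \<in> {0..1} \<Longrightarrow> dist \<sigma> \<tau> < e \<Longrightarrow> H (\<sigma>, s) \<in> W"
        using ts unfolding openin_euclidean_subtopology_iff by blast
      \<comment> \<open>The radius is halved so that the closed ball stays where
        \<open>H (\<sigma>, s) \<in> W\<close>. Compactness of \<open>K\<close> serves the tube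
        argument; the open ball of the same radius becomes the interval factor
        \<open>J\<close>.\<close>
      define K where "K = cball \<tau> (e/2) \<inter> {0..1}"
      have K: "K \<subseteq> {0..1}" "compact K"
        by (auto simp: K_def intro!: compact_Int)
      have Ks: "H (\<sigma>, s) \<in> W" if "\<sigma> \<in> K" for \<sigma>
        using that e by (auto simp: K_def dist_commute)
      define U where "U = {x \<in> coherent_carrier \<Delta>. \<forall>\<sigma>\<in>K. H (\<sigma>, x) \<in> W}"
      have "openin (simplex_top D) (U \<inter> geom_simplex D)" if D: "D \<in> \<Delta>" for D
      proof -
        let ?P = "prod_topology (top_of_set K) (simplex_top D)"
        have "continuous_map ?P Y H"
          using H[OF D] K(1)
          by (metis (no_types, lifting) continuous_map_from_subtopology inf.absorb_iff2 prod_topology_subtopology(1)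
              subtopology_subtopology)
        then have "closedin ?P {z \<in> topspace ?P. H z \<in> topspace Y - W}"
          using W closedin_continuous_map_preimage by blast
        \<comment> \<open>Projection along the compact factor \<open>K\<close> is closed, so the
          points with a bad value somewhere over \<open>K\<close> form a closed set. Its complement
          in the simplex is the trace of \<open>U\<close>.\<close>
        moreover have "closed_map ?P (simplex_top D) snd"
          by (intro closed_map_snd) (use K in \<open>auto simp: compact_space_subtopology\<close>)
        ultimately have cl: "closedin (simplex_top D) (snd ` {z \<in> topspace ?P. H z \<in> topspace Y - W})"
          unfolding closed_map_def by blast
        have eq: "U \<inter> geom_simplex D =
            topspace (simplex_top D) - snd ` {z \<in> topspace ?P. H z \<in> topspace Y - W}"
        proof -
          have "H (\<sigma>, x) \<in> topspace Y" if "x \<in> geom_simplex D" "\<sigma> \<in> K" for x \<sigma>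
            using that K(1) fs geom_simplex_subset_carrier[OF D] by blast
          moreover have "x \<in> snd ` {z \<in> topspace ?P. H z \<in> topspace Y - W} \<longleftrightarrow>
              x \<in> geom_simplex D \<and> (\<exists>\<sigma>\<in>K. H (\<sigma>, x) \<in> topspace Y - W)" for x
            by (auto simp: image_iff)
          ultimately show ?thesis
            using geom_simplex_subset_carrier[OF D] unfolding U_def topspace_simplex_top by blast
        qed
        show ?thesis
          unfolding eq by (rule openin_diff[OF openin_topspace cl])
      qed
      then have "openin (coherent_topology \<Delta>) U"
        by (auto simp: openin_coherent U_def)
      moreover have "openin (top_of_set {0..1}) (ball \<tau> (e/2) \<inter> {0..1})"
        by (metis Int_commute open_ball openin_open_Int)
      moreover have "s \<in> U" "\<tau> \<in> ball \<tau> (e/2) \<inter> {0..1}"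
        using ts Ks e by (auto simp: U_def)
      moreover have "(ball \<tau> (e/2) \<inter> {0..1}) \<times> U \<subseteq> {z \<in> {0..1} \<times> coherent_carrier \<Delta>. H z \<in> W}"
        by (auto simp: U_def K_def)
      ultimately show ?thesis by blast
    qed
    then show "openin (prod_topology (top_of_set {0..1}) (coherent_topology \<Delta>))
        {z \<in> topspace (prod_topology (top_of_set {0..1}) (coherent_topology \<Delta>)). H z \<in> W}"
      unfolding openin_prod_topology_alt
      by (intro allI impI) (simp only: mem_Collect_eq topspace_prod_topology topspace_coherent
          topspace_euclidean_subtopology mem_Times_iff fst_conv snd_conv)
  qed
qed

section \<open>Straight-line homotopies\<close>

lemma geom_simplex_convex:
  assumes "t \<in> geom_simplex C" "u \<in> geom_simplex C" "\<tau> \<in> {0..1::real}"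
  shows "(\<lambda>x. (1 - \<tau>) * t x + \<tau> * u x) \<in> geom_simplex C"
  using assms by (auto simp: geom_simplex_def sum.distrib simp flip: sum_distrib_left)

text \<open>The segment between the two images of a point stays in the common simplex, which is
  convex. Finiteness of that simplex lets joint continuity be tested coordinatewise, one source
  simplex at a time.\<close>

lemma homotopic_coherent_linear:
  assumes p: "continuous_map (coherent_topology \<Gamma>) (coherent_topology \<Delta>) p" and q: "continuous_map (coherent_topology \<Gamma>) (coherent_topology \<Delta>) q"
    and common: "\<And>C. C \<in> \<Gamma> \<Longrightarrow> \<exists>D\<in>\<Delta>. finite D \<and>
        p ` geom_simplex C \<subseteq> geom_simplex D \<and> q ` geom_simplex C \<subseteq> geom_simplex D"
  shows "homotopic_with (\<lambda>_. True) (coherent_topology \<Gamma>) (coherent_topology \<Delta>) p q"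
proof -
  define H where "H = (\<lambda>(\<tau>::real, t). (\<lambda>x. (1 - \<tau>) * p t x + \<tau> * q t x))"
  have "continuous_map (prod_topology (top_of_set {0..1}) (coherent_topology \<Gamma>)) (coherent_topology \<Delta>) H"
  proof (rule continuous_map_prod_coherent)
    fix C assume C: "C \<in> \<Gamma>"
    let ?P = "prod_topology (top_of_set {0..1::real}) (simplex_top C)"
    obtain D where D: "D \<in> \<Delta>" "finite D" "p ` geom_simplex C \<subseteq> geom_simplex D"
      "q ` geom_simplex C \<subseteq> geom_simplex D"
      using common[OF C] by blast
    have coord: "continuous_map ?P euclideanreal (\<lambda>z. r (snd z) x)"
      if r: "continuous_map (coherent_topology \<Gamma>) (coherent_topology \<Delta>) r" for r x
    proof -
      have "continuous_map (simplex_top C) (powertop_real UNIV) (id \<circ> r)"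
        using r C continuous_map_compose[OF _ continuous_map_coherent_powertop] unfolding continuous_map_coherent_iff
        by blast
      then have "continuous_map (simplex_top C) euclideanreal (\<lambda>t. r t x)"
        by (simp add: continuous_map_componentwise_UNIV)
      from continuous_map_compose[OF continuous_map_snd this] show ?thesis
        by (simp add: o_def)
    qed
    have fs: "continuous_map ?P euclideanreal fst"
      using continuous_map_fst continuous_map_into_fulltopology by blast
    have "continuous_map ?P (powertop_real UNIV) H"
      unfolding continuous_map_componentwise_UNIV H_def case_prod_unfold
      by (intro allI continuous_intros coord p q fs) auto
    then show "continuous_map ?P (coherent_topology \<Delta>) H"
      by (rule continuous_map_into_coherent_simplex[OF _ D(2,1)])
        (use D(3,4) in \<open>auto simp: H_def image_subset_iff intro!: geom_simplex_convex\<close>)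
  qed
  then show ?thesis
    unfolding homotopic_with_def by (intro exI[of _ H]) (auto simp: H_def)
qed

section \<open>Barycentric subdivision\<close>

text \<open>On a subdivision this is the affine extension of the map sending the vertex
  \<open>Y\<close> to the barycentre of the simplex spanned by \<open>Y\<close>. Summing over the
  support of \<open>s\<close> avoids choosing a chain that carries \<open>s\<close>.\<close>

definition bary :: "('x set \<Rightarrow> real) \<Rightarrow> 'x \<Rightarrow> real" where
  "bary s x = (\<Sum>Y\<in>{Y. s Y \<noteq> 0 \<and> x \<in> Y}. s Y / card Y)"

text \<open>The inverse of \<^const>\<open>bary\<close> on barycentric subdivisions: the sets carrying weight are the
  superlevel sets of \<open>t\<close>, weighted by their size times the height of the gap below them.\<close>
definition layers :: "('x \<Rightarrow> real) \<Rightarrow> 'x set \<Rightarrow> real" where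
  "layers t Y = (if finite Y \<and> Y \<noteq> {}
     then real (card Y) * max 0 (Min (t ` Y) - Max (insert 0 (t ` (- Y)))) else 0)"

lemma bary_eq_sum:
  assumes "finite K" "\<And>Y. Y \<notin> K \<Longrightarrow> s Y = 0"
  shows "bary s x = (\<Sum>Y\<in>{Y \<in> K. x \<in> Y}. s Y / card Y)"
  unfolding bary_def using assms by (intro sum.mono_neutral_left) auto

lemma finite_chain_Union_mem:
  assumes "finite K" "K \<noteq> {}" "\<And>X Y. X \<in> K \<Longrightarrow> Y \<in> K \<Longrightarrow> X \<subseteq> Y \<or> Y \<subseteq> X"
  shows "\<Union>K \<in> K"
  using assms by (intro Union_in_chain[where \<A> = UNIV]) (auto simp: subset.chain_def)

lemma finite_chain_Inter_mem:
  assumes "finite K" "K \<noteq> {}" "\<And>X Y. X \<in> K \<Longrightarrow> Y \<in> K \<Longrightarrow> X \<subseteq> Y \<or> Y \<subseteq> X"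
  shows "\<Inter>K \<in> K"
  using assms by (intro Inter_in_chain[where \<A> = UNIV]) (auto simp: subset.chain_def)

text \<open>With \<open>w Z = s Z / card Z\<close>, the value of \<open>bary s\<close> at
  \<open>x\<close> is the sum of \<open>w Z\<close> over the members containing \<open>x\<close>.
  Let \<open>A\<close> be the sum over the members strictly above \<open>Y\<close>. The minimum on
  \<open>Y\<close> is \<open>w Y + A\<close>; the maximum off \<open>Y\<close> is \<open>A\<close>
  if \<open>Y\<close> is a member and at least \<open>A\<close> otherwise. So the gap is
  \<open>w Y\<close> in the first case; in the second, where \<open>w Y = 0\<close>, it is cut off
  at zero.\<close>

lemma layers_bary:
  assumes K: "finite K" "\<And>X Y. X \<in> K \<Longrightarrow> Y \<in> K \<Longrightarrow> X \<subseteq> Y \<or> Y \<subseteq> X"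
    and ne: "\<And>Y. Y \<in> K \<Longrightarrow> finite Y \<and> Y \<noteq> {}"
    and s: "\<And>Y. 0 \<le> s Y" "\<And>Y. Y \<notin> K \<Longrightarrow> s Y = 0"
  shows "layers (bary s) = s"
proof
  fix Y
  define \<beta> where "\<beta> = bary s"
  define w where "w = (\<lambda>Z. s Z / card Z)"
  have w0: "w Z \<ge> 0" for Z
    using s by (simp add: w_def)
  have \<beta>: "\<beta> x = sum w {Z \<in> K. x \<in> Z}" for x
    unfolding \<beta>_def w_def by (rule bary_eq_sum) (use K s in auto)
  show "layers (bary s) Y = s Y"
  proof (cases "finite Y \<and> Y \<noteq> {}")
    case False
    then show ?thesis
      using ne s by (auto simp: layers_def)
  next
    case True
    define A where "A = sum w {Z \<in> K. Y \<subset> Z}"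
    have A0: "A \<ge> 0"
      using w0 by (simp add: A_def sum_nonneg)
    \<comment> \<open>\<open>Max\<close> over the possibly infinite complement is meaningful because
      \<open>\<beta>\<close> vanishes off the finite set \<open>\<Union>K\<close>.\<close>
    have fin: "finite (\<beta> ` (- Y))"
    proof (rule finite_subset)
      show "\<beta> ` (- Y) \<subseteq> insert 0 (\<beta> ` \<Union>K)"
        by (auto simp: \<beta> intro!: sum.neutral)
    qed (use K ne in auto)
    have wY: "sum w {Z \<in> K. Y \<subseteq> Z} = w Y + A"
    proof -
      have "sum w {Z \<in> K. Y \<subseteq> Z} = sum w (insert Y {Z \<in> K. Y \<subset> Z})"
        using K s(2)[of Y] by (intro sum.mono_neutral_left) (auto simp: w_def)
      then show ?thesis
        using K by (simp add: A_def)
    qed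
    \<comment> \<open>The members that do not contain \<open>Y\<close> form a chain. The largest of
      them misses some point of \<open>Y\<close>, and this point lies in none of them.\<close>
    obtain x0 where x0: "x0 \<in> Y" "\<And>Z. Z \<in> K \<Longrightarrow> \<not> Y \<subseteq> Z \<Longrightarrow> x0 \<notin> Z"
    proof (cases "{Z \<in> K. \<not> Y \<subseteq> Z} = {}")
      case False
      then have "\<Union>{Z \<in> K. \<not> Y \<subseteq> Z} \<in> {Z \<in> K. \<not> Y \<subseteq> Z}"
        using K by (intro finite_chain_Union_mem) auto
      then have "\<not> Y \<subseteq> \<Union>{Z \<in> K. \<not> Y \<subseteq> Z}" by blast
      then show ?thesis using that by blast
    qed (use True that in blast)
    have ge: "w Y + A \<le> \<beta> x" if "x \<in> Y" for x
      unfolding wY[symmetric] \<beta> using that K w0 by (intro sum_mono2) auto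
    have "{Z \<in> K. x0 \<in> Z} = {Z \<in> K. Y \<subseteq> Z}"
      using x0 by blast
    then have "\<beta> x0 = w Y + A"
      by (simp add: \<beta> wY)
    then have Min: "Min (\<beta> ` Y) = w Y + A"
      using True x0 ge by (intro Min_eqI) force+
    \<comment> \<open>The smallest member strictly above \<open>Y\<close> has a point
      \<open>y\<close> outside \<open>Y\<close>, which lies in every member counted by
      \<open>A\<close>. If there is no such member, \<open>A = 0\<close> and the inserted
      \<open>0\<close> gives the bound.\<close>
    have Max_ge: "A \<le> Max (insert 0 (\<beta> ` (- Y)))"
    proof (cases "{Z \<in> K. Y \<subset> Z} = {}")
      case False
      then have "\<Inter>{Z \<in> K. Y \<subset> Z} \<in> {Z \<in> K. Y \<subset> Z}"
        using K by (intro finite_chain_Inter_mem) auto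
      then have "Y \<subset> \<Inter>{Z \<in> K. Y \<subset> Z}" by simp
      then obtain y where "y \<notin> Y" "y \<in> \<Inter>{Z \<in> K. Y \<subset> Z}"
        by (meson psubset_imp_ex_mem DiffE)
      then have y: "y \<notin> Y" "\<And>Z. Z \<in> K \<Longrightarrow> Y \<subset> Z \<Longrightarrow> y \<in> Z" by simp_all
      then have "A \<le> \<beta> y"
        unfolding A_def \<beta> using K w0 by (intro sum_mono2) auto
      also have "\<dots> \<le> Max (insert 0 (\<beta> ` (- Y)))"
        using fin y by (intro Max_ge) auto
      finally show ?thesis .
    next
      case True
      show ?thesis
        unfolding A_def True using fin by (intro Max_ge) auto
    qed
    show ?thesis
    proof (cases "Y \<in> K")
      case True
      have "\<beta> x \<le> A" if "x \<notin> Y" for x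
      proof -
        have "{Z \<in> K. x \<in> Z} \<subseteq> {Z \<in> K. Y \<subset> Z}"
          using that K(2)[OF True] by blast
        then show ?thesis
          unfolding A_def \<beta> using K w0 by (intro sum_mono2) auto
      qed
      then have "Max (insert 0 (\<beta> ` (- Y))) \<le> A"
        using fin A0 by (intro Max.boundedI) auto
      with Max_ge have "Max (insert 0 (\<beta> ` (- Y))) = A" by simp
      with Min w0[of Y] ne[OF True] show ?thesis
        by (simp add: layers_def w_def flip: \<beta>_def)
    next
      case False
      then show ?thesis
        using Max_ge Min s by (simp add: layers_def w_def flip: \<beta>_def)
    qed
  qed
qed

text \<open>Induction on the support \<open>C\<close>: subtracting the minimum \<open>\<mu>\<close>
  of \<open>t\<close> on \<open>C\<close> removes a point from the support, and giving the set
  \<open>C\<close> the weight \<open>\<mu> * card C\<close> restores \<open>\<mu>\<close> at each of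
  its points. All other sets lie in the smaller support, so \<open>C\<close> sits on top of the
  chain.\<close>

lemma chain_decomposition:
  assumes "finite C" "\<And>x. 0 \<le> t x" "{x. t x \<noteq> 0} = C"
  shows "\<exists>K s. K \<subseteq> Pow C - {{}} \<and> (\<forall>X\<in>K. \<forall>Y\<in>K. X \<subseteq> Y \<or> Y \<subseteq> X) \<and>
           (\<forall>Y. (0::real) \<le> s Y) \<and> (\<forall>Y. Y \<notin> K \<longrightarrow> s Y = 0) \<and> bary s = t"
  using assms
proof (induction C arbitrary: t rule: finite_psubset_induct)
  case (psubset C)
  show ?case
  proof (cases "C = {}")
    case True
    with psubset.prems have "bary (\<lambda>_. 0) = t"
      by (auto simp: bary_def fun_eq_iff)
    with True show ?thesis
      by (intro exI[of _ "{}"] exI[of _ "\<lambda>_. 0"]) auto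
  next
    case False
    define \<mu> where "\<mu> = Min (t ` C)"
    define t' where "t' = (\<lambda>x. if x \<in> C then t x - \<mu> else 0)"
    have le: "\<mu> \<le> t x" if "x \<in> C" for x
      using that psubset.hyps by (simp add: \<mu>_def)
    have "\<mu> \<in> t ` C"
      unfolding \<mu>_def by (rule Min_in) (use False psubset.hyps in auto)
    then obtain x0 where x0: "x0 \<in> C" "t x0 = \<mu>" by blast
    have "{x. t' x \<noteq> 0} \<subset> C"
      using x0 by (auto simp: t'_def)
    moreover have "0 \<le> t' x" for x
      using le by (simp add: t'_def)
    ultimately obtain K s where K: "K \<subseteq> Pow {x. t' x \<noteq> 0} - {{}}" "\<forall>X\<in>K. \<forall>Y\<in>K. X \<subseteq> Y \<or> Y \<subseteq> X"
      "\<forall>Y. 0 \<le> s Y" "\<forall>Y. Y \<notin> K \<longrightarrow> s Y = 0" "bary s = t'"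
      using psubset.IH[of "{x. t' x \<noteq> 0}" t'] by auto
    have KC: "Y \<subset> C" if "Y \<in> K" for Y
      using that K(1) \<open>{x. t' x \<noteq> 0} \<subset> C\<close> by blast
    have fin: "finite K"
      by (rule finite_subset[of _ "Pow C"]) (use KC psubset.hyps in auto)
    define s' where "s' = s(C := \<mu> * card C)"
    have "bary s' x = t x" for x
    proof -
      have "bary s' x = (\<Sum>Y\<in>{Y \<in> insert C K. x \<in> Y}. s' Y / card Y)"
        using K fin by (intro bary_eq_sum) (auto simp: s'_def)
      also have "\<dots> = (if x \<in> C then \<mu> else 0) + (\<Sum>Y\<in>{Y \<in> K. x \<in> Y}. s' Y / card Y)"
      proof (cases "x \<in> C")
        case True
        then have "{Y \<in> insert C K. x \<in> Y} = insert C {Y \<in> K. x \<in> Y}" by auto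
        moreover have "C \<notin> K" using KC by blast
        ultimately show ?thesis
          using fin True psubset.hyps False by (simp add: s'_def)
      next
        case x: False
        then have "{Y \<in> insert C K. x \<in> Y} = {Y \<in> K. x \<in> Y}" by auto
        then show ?thesis using x by simp
      qed
      also have "(\<Sum>Y\<in>{Y \<in> K. x \<in> Y}. s' Y / card Y) = (\<Sum>Y\<in>{Y \<in> K. x \<in> Y}. s Y / card Y)"
        using KC by (intro sum.cong) (auto simp: s'_def)
      also have "\<dots> = t' x"
        using K fin by (subst bary_eq_sum[symmetric]) auto
      finally show ?thesis
        using psubset.prems by (auto simp: t'_def)
    qed
    moreover have "\<mu> \<ge> 0"
      using x0 psubset.prems by metis
    ultimately have s': "bary s' = t" "0 \<le> s' Y" for Y
      using K(3) by (auto simp: s'_def)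
    moreover have sub: "insert C K \<subseteq> Pow C - {{}}"
      using K(1) KC False by (auto simp: psubset_eq)
    moreover have "\<forall>X\<in>insert C K. \<forall>Y\<in>insert C K. X \<subseteq> Y \<or> Y \<subseteq> X"
      using K(2) sub by auto
    moreover have "s' Y = 0" if "Y \<notin> insert C K" for Y
      using that K(4) by (simp add: s'_def)
    ultimately show ?thesis by blast
  qed
qed

text \<open>Each \<open>Y\<close> spreads \<open>s Y\<close> evenly over its \<open>card Y\<close>
  points; exchanging the sums collects it again.\<close>

lemma sum_bary:
  assumes C: "finite C" and K: "K \<subseteq> Pow C - {{}}" and s: "\<And>Y. Y \<notin> K \<Longrightarrow> s Y = 0"
  shows "sum (bary s) C = sum s K"
proof -
  have fin: "finite K"
    by (rule finite_subset[OF K]) (use C in auto)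
  have "sum (bary s) C = (\<Sum>x\<in>C. \<Sum>Y\<in>{Y \<in> K. x \<in> Y}. s Y / card Y)"
    by (simp add: bary_eq_sum[OF fin s])
  also have "\<dots> = (\<Sum>Y\<in>K. \<Sum>x\<in>{x \<in> C. x \<in> Y}. s Y / card Y)"
    by (rule sum.swap_restrict[OF C fin])
  also have "\<dots> = sum s K"
  proof (rule sum.cong)
    fix Y assume "Y \<in> K"
    then have "{x \<in> C. x \<in> Y} = Y" "finite Y" "Y \<noteq> {}"
      using K C by (auto intro: finite_subset)
    then show "(\<Sum>x\<in>{x \<in> C. x \<in> Y}. s Y / card Y) = s Y"
      by simp
  qed simp
  finally show ?thesis .
qed

lemma bary_in_geom_simplex:
  assumes C: "finite C" and K: "K \<subseteq> Pow C - {{}}" and s: "s \<in> geom_simplex K"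
  shows "bary s \<in> geom_simplex C"
proof -
  have fin: "finite K"
    by (rule finite_subset[OF K]) (use C in auto)
  have s0: "0 \<le> s Y" "Y \<notin> K \<Longrightarrow> s Y = 0" "sum s K = 1" for Y
    using s by (auto simp: geom_simplex_def)
  have b: "bary s x = (\<Sum>Y\<in>{Y \<in> K. x \<in> Y}. s Y / card Y)" for x
    using fin s0 by (intro bary_eq_sum) auto
  have "sum (bary s) C = 1"
    using sum_bary[OF C K] s0 by simp
  moreover have "0 \<le> bary s x" for x
    using s0 by (auto simp: b intro!: sum_nonneg)
  moreover have "bary s x = 0" if "x \<notin> C" for x
    unfolding b using that K by (intro sum.neutral) auto
  ultimately show ?thesis
    by (simp add: geom_simplex_def)
qed

text \<open>Once \<open>t\<close> is written as \<open>bary s\<close> along a chain,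
  \<open>layers_bary\<close> forces \<open>s = layers t\<close>. Preservation of the total mass
  gives the sum 1 and hence a nonempty chain.\<close>

lemma layers_in_geom_simplex:
  assumes C: "finite C" and t: "t \<in> geom_simplex C"
  obtains K where "K \<in> poset_chains (Pow C - {{}}) (\<subseteq>)" "layers t \<in> geom_simplex K"
proof -
  define D where "D = {x. t x \<noteq> 0}"
  have t0: "0 \<le> t x" for x
    using t by (simp add: geom_simplex_def)
  have D: "D \<subseteq> C"
    using t by (auto simp: D_def geom_simplex_def)
  obtain K s where K: "K \<subseteq> Pow D - {{}}" "\<forall>X\<in>K. \<forall>Y\<in>K. X \<subseteq> Y \<or> Y \<subseteq> X"
      and s: "\<forall>Y. 0 \<le> s Y" "\<forall>Y. Y \<notin> K \<longrightarrow> s Y = 0" "bary s = t"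
    using chain_decomposition[OF finite_subset[OF D C] t0 D_def[symmetric]] by iprover
  have KC: "K \<subseteq> Pow C - {{}}"
    using K(1) D by blast
  have fin: "finite K"
    by (rule finite_subset[OF KC]) (use C in auto)
  have "layers t = s"
    unfolding s(3)[symmetric]
  proof (rule layers_bary[OF fin])
    show "finite Y \<and> Y \<noteq> {}" if "Y \<in> K" for Y
      using that KC C finite_subset[of Y C] by auto
  qed (use K s in auto)
  moreover have "sum s K = 1"
    using sum_bary[OF C KC, of s] s t by (simp add: geom_simplex_def)
  ultimately have "layers t \<in> geom_simplex K" "K \<noteq> {}"
    using s by (auto simp: geom_simplex_def)
  then show ?thesis
    using that[of K] K KC fin by (simp add: poset_chains_def)
qed

section \<open>Continuity of the subdivision maps\<close>

lemma continuous_map_real_Min: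
  fixes f :: "'i \<Rightarrow> 'x \<Rightarrow> real"
  assumes "finite I" "I \<noteq> {}" "\<And>i. i \<in> I \<Longrightarrow> continuous_map X euclideanreal (f i)"
  shows "continuous_map X euclideanreal (\<lambda>x. Min ((\<lambda>i. f i x) ` I))"
  using assms
proof (induction I rule: finite_ne_induct)
  case (insert i I)
  then have "continuous_map X euclideanreal (\<lambda>x. min (f i x) (Min ((\<lambda>i. f i x) ` I)))"
    by (intro continuous_map_real_min) auto
  with insert show ?case by (simp add: Min_insert)
qed simp

lemma continuous_map_real_Max:
  fixes f :: "'i \<Rightarrow> 'x \<Rightarrow> real"
  assumes "finite I" "I \<noteq> {}" "\<And>i. i \<in> I \<Longrightarrow> continuous_map X euclideanreal (f i)"
  shows "continuous_map X euclideanreal (\<lambda>x. Max ((\<lambda>i. f i x) ` I))"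
  using assms
proof (induction I rule: finite_ne_induct)
  case (insert i I)
  then have "continuous_map X euclideanreal (\<lambda>x. max (f i x) (Max ((\<lambda>i. f i x) ` I)))"
    by (intro continuous_map_real_max) auto
  with insert show ?case by (simp add: Max_insert)
qed simp

lemma continuous_map_layers_coordinate:
  assumes C: "finite C"
  shows "continuous_map (simplex_top C) euclideanreal (\<lambda>t. layers t Y)"
proof (cases "finite Y \<and> Y \<noteq> {}")
  case True
  \<comment> \<open>On the simplex \<open>t\<close> vanishes off \<open>C\<close>, so the maximum
    over the complement of \<open>Y\<close> involves only finitely many coordinates and the value 0,
    which the index \<open>None\<close> encodes.\<close>
  let ?f = "\<lambda>t. Max ((\<lambda>i. case i of None \<Rightarrow> 0 | Some x \<Rightarrow> t x) ` insert None (Some ` (C - Y)))"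
  have M: "continuous_map (simplex_top C) euclideanreal ?f"
    using C by (intro continuous_map_real_Max) (auto intro: continuous_map_coordinate)
  have eq: "?f t = Max (insert 0 (t ` (- Y)))" if "t \<in> geom_simplex C" for t
  proof -
    have "t ` (- Y) \<subseteq> insert 0 (t ` (C - Y))"
      using that by (auto simp: geom_simplex_def)
    then have "insert 0 (t ` (- Y)) = insert 0 (t ` (C - Y))" by blast
    then show ?thesis by (simp add: image_image)
  qed
  have "continuous_map (simplex_top C) euclideanreal (\<lambda>t. real (card Y) * max 0 (Min (t ` Y) - ?f t))"
    using True
    by (intro continuous_map_real_mult_left continuous_map_real_max continuous_map_diff M
        continuous_map_real_Min continuous_map_coordinate) auto
  then show ?thesis
    by (rule continuous_map_eq) (use True eq in \<open>simp add: layers_def\<close>)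
next
  case False
  then have "(\<lambda>t. layers t Y) = (\<lambda>t. 0)"
    by (auto simp: layers_def fun_eq_iff)
  then show ?thesis by simp
qed

text \<open>Only finitely many chains consist of nonempty subsets of a simplex \<open>C\<close>, so
  \<open>C\<close> is mapped into a finite subcomplex, where continuity can be tested
  coordinatewise.\<close>

lemma continuous_map_layers:
  assumes fin: "\<And>C. C \<in> \<Delta> \<Longrightarrow> finite C"
    and sub: "\<And>C D. C \<in> \<Delta> \<Longrightarrow> D \<subseteq> C \<Longrightarrow> D \<noteq> {} \<Longrightarrow> D \<in> \<Delta>"
  shows "continuous_map (coherent_topology \<Delta>) (coherent_topology (poset_chains \<Delta> (\<subseteq>))) layers"
  unfolding continuous_map_coherent_iff
proof
  fix C assume C: "C \<in> \<Delta>"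
  let ?\<Gamma> = "poset_chains (Pow C - {{}}) (\<subseteq>)"
  have G: "?\<Gamma> \<subseteq> Pow (Pow C)"
    by (auto simp: poset_chains_def)
  show "continuous_map (simplex_top C) (coherent_topology (poset_chains \<Delta> (\<subseteq>))) layers"
  proof (rule continuous_map_into_coherent[where \<Gamma> = ?\<Gamma>])
    show "continuous_map (simplex_top C) (powertop_real UNIV) layers"
      unfolding continuous_map_componentwise_UNIV
      using continuous_map_layers_coordinate fin[OF C] by blast
    show "finite ?\<Gamma>"
      by (rule finite_subset[OF G]) (use fin[OF C] in auto)
    show "?\<Gamma> \<subseteq> poset_chains \<Delta> (\<subseteq>)"
    proof -
      have "Pow C - {{}} \<subseteq> \<Delta>"
        using sub[OF C] by auto
      then show ?thesis
        by (auto simp: poset_chains_def)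
    qed
    show "layers \<in> topspace (simplex_top C) \<rightarrow> \<Union> (geom_simplex ` ?\<Gamma>)"
    proof
      fix t assume "t \<in> topspace (simplex_top C)"
      then obtain K where "K \<in> ?\<Gamma>" "layers t \<in> geom_simplex K"
        by (auto intro: layers_in_geom_simplex[OF fin[OF C]])
      then show "layers t \<in> \<Union> (geom_simplex ` ?\<Gamma>)" by blast
    qed
  qed (auto simp: poset_chains_def)
qed

lemma chain_Union:
  assumes "C \<in> poset_chains P (\<subseteq>)"
  shows "\<Union>C \<in> C"
  using assms by (intro finite_chain_Union_mem) (auto simp: poset_chains_def)

lemma bary_chain_in_geom_simplex:
  assumes fin: "\<And>C. C \<in> \<Delta> \<Longrightarrow> finite C \<and> C \<noteq> {}"
    and C: "C \<in> poset_chains \<Delta> (\<subseteq>)" and s: "s \<in> geom_simplex C"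
  shows "bary s \<in> geom_simplex (\<Union>C)"
proof (rule bary_in_geom_simplex[OF _ _ s])
  have "C \<subseteq> \<Delta>" "finite C"
    using C by (auto simp: poset_chains_def)
  with fin show "finite (\<Union>C)" "C \<subseteq> Pow (\<Union>C) - {{}}"
    by blast+
qed

text \<open>A chain is carried into the single simplex spanned by its largest member
  \<open>\<Union>C\<close>, with coordinates that are finite linear combinations.\<close>

lemma continuous_map_bary:
  assumes fin: "\<And>C. C \<in> \<Delta> \<Longrightarrow> finite C \<and> C \<noteq> {}"
  shows "continuous_map (coherent_topology (poset_chains \<Delta> (\<subseteq>))) (coherent_topology \<Delta>) bary"
  unfolding continuous_map_coherent_iff
proof
  fix C assume C: "C \<in> poset_chains \<Delta> (\<subseteq>)"
  then have C': "finite C" "C \<subseteq> \<Delta>" by (auto simp: poset_chains_def)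
  show "continuous_map (simplex_top C) (coherent_topology \<Delta>) bary"
  proof (rule continuous_map_into_coherent_simplex[where C = "\<Union>C"])
    show "continuous_map (simplex_top C) (powertop_real UNIV) bary"
      unfolding continuous_map_componentwise_UNIV
    proof
      fix x
      have "continuous_map (simplex_top C) euclideanreal (\<lambda>s. \<Sum>Y\<in>{Y \<in> C. x \<in> Y}. s Y / card Y)"
        using C' fin
        by (intro continuous_map_sum continuous_map_real_divide continuous_map_coordinate) (auto simp: subset_iff)
      then show "continuous_map (simplex_top C) euclideanreal (\<lambda>s. bary s x)"
        by (rule continuous_map_eq) (use C' in \<open>auto simp: geom_simplex_def bary_eq_sum\<close>)
    qed
    show "bary \<in> topspace (simplex_top C) \<rightarrow> geom_simplex (\<Union>C)"
      using bary_chain_in_geom_simplex[OF fin C] by auto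
    show "\<Union>C \<in> \<Delta>" "finite (\<Union>C)"
      using chain_Union[OF C] C' fin by auto
  qed
qed

lemma layers_bary_id:
  assumes fin: "\<And>C. C \<in> \<Delta> \<Longrightarrow> finite C \<and> C \<noteq> {}"
    and s: "s \<in> coherent_carrier (poset_chains \<Delta> (\<subseteq>))"
  shows "layers (bary s) = s"
proof -
  obtain C where "C \<in> poset_chains \<Delta> (\<subseteq>)" "s \<in> geom_simplex C"
    using s by (auto simp: coherent_carrier_def)
  then show ?thesis
    using fin by (intro layers_bary[of C]) (auto simp: poset_chains_def geom_simplex_def subset_iff)
qed

section \<open>Maps of realisations induced by vertex maps\<close>

lemma realise_map_eq_sum:
  assumes "finite C" "t \<in> geom_simplex C"
  shows "realise_map f t y = (\<Sum>x\<in>{x \<in> C. f x = y}. t x)"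
  unfolding realise_map_def using assms by (intro sum.mono_neutral_left) (auto simp: geom_simplex_def)

lemma realise_map_in_geom_simplex:
  assumes C: "finite C" and t: "t \<in> geom_simplex C"
  shows "realise_map f t \<in> geom_simplex (f ` C)"
proof -
  have "(\<Sum>y\<in>f ` C. realise_map f t y) = sum t C"
    using sum.image_gen[OF C, of t f] by (simp add: realise_map_eq_sum[OF assms])
  moreover have "0 \<le> realise_map f t y" for y
    using t by (auto simp: realise_map_def geom_simplex_def intro!: sum_nonneg)
  moreover have "realise_map f t y = 0" if "y \<notin> f ` C" for y
    unfolding realise_map_eq_sum[OF assms] using that by (intro sum.neutral) auto
  ultimately show ?thesis
    using t by (simp add: geom_simplex_def)
qed

lemma continuous_map_realise_map:
  assumes fin: "\<And>C. C \<in> \<Gamma> \<Longrightarrow> finite C" and im: "\<And>C. C \<in> \<Gamma> \<Longrightarrow> f ` C \<in> \<Delta>"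
  shows "continuous_map (coherent_topology \<Gamma>) (coherent_topology \<Delta>) (realise_map f)"
  unfolding continuous_map_coherent_iff
proof
  fix C assume C: "C \<in> \<Gamma>"
  show "continuous_map (simplex_top C) (coherent_topology \<Delta>) (realise_map f)"
  proof (rule continuous_map_into_coherent_simplex[where C = "f ` C"])
    show "continuous_map (simplex_top C) (powertop_real UNIV) (realise_map f)"
      unfolding continuous_map_componentwise_UNIV
    proof
      fix y
      have "continuous_map (simplex_top C) euclideanreal (\<lambda>t. \<Sum>x\<in>{x \<in> C. f x = y}. t x)"
        using fin[OF C] by (intro continuous_map_sum continuous_map_coordinate) auto
      then show "continuous_map (simplex_top C) euclideanreal (\<lambda>t. realise_map f t y)"
        by (rule continuous_map_eq) (use fin[OF C] in \<open>simp add: realise_map_eq_sum\<close>)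
    qed
    show "realise_map f \<in> topspace (simplex_top C) \<rightarrow> geom_simplex (f ` C)"
      using realise_map_in_geom_simplex[OF fin[OF C], of _ f] by simp
  qed (use C fin im in auto)
qed

lemma poset_chains_image:
  assumes "C \<in> poset_chains P (\<subseteq>)" "\<And>x. x \<in> P \<Longrightarrow> f x \<in> Q"
    and "\<And>x y. x \<in> P \<Longrightarrow> y \<in> P \<Longrightarrow> x \<subseteq> y \<Longrightarrow> f x \<subseteq> f y"
  shows "f ` C \<in> poset_chains Q (\<subseteq>)"
proof -
  have C: "C \<subseteq> P" "finite C" "C \<noteq> {}" "\<And>x y. x \<in> C \<Longrightarrow> y \<in> C \<Longrightarrow> x \<subseteq> y \<or> y \<subseteq> x"
    using assms(1) by (auto simp: poset_chains_def)
  have "f x \<subseteq> f y \<or> f y \<subseteq> f x" if "x \<in> C" "y \<in> C" for x y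
    using C(1) C(4)[OF that] that assms(3) by (meson subsetD)
  moreover have "f ` C \<subseteq> Q"
    using C(1) assms(2) by blast
  ultimately show ?thesis
    using C(2,3) by (simp add: poset_chains_def)
qed

section \<open>Homotopy equivalences of posets\<close>

lemma poset_chains_subset:
  "C \<in> poset_chains P le \<Longrightarrow> D \<subseteq> C \<Longrightarrow> D \<noteq> {} \<Longrightarrow> D \<in> poset_chains P le"
  using finite_subset[of D C] by (auto simp: poset_chains_def)

text \<open>The order-theoretic core: \<open>f\<close> acts as a closure operator from faces in
  \<open>S\<close> to closed sets in \<open>G\<close>. \<open>S_Un\<close> supplies the simplices
  that hold the straight lines: faces inside one member of \<open>G\<close> span a common
  face.\<close>

theorem homotopy_equivalence_realise_map:
  fixes S :: "'v set set" and G :: "'v set set"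
  assumes S_fin: "\<And>Y. Y \<in> S \<Longrightarrow> finite Y \<and> Y \<noteq> {}"
    and S_sub: "\<And>Y Z. Y \<in> S \<Longrightarrow> Z \<subseteq> Y \<Longrightarrow> Z \<noteq> {} \<Longrightarrow> Z \<in> S"
    and S_Un: "\<And>N Y Z. N \<in> G \<Longrightarrow> Y \<in> S \<Longrightarrow> Z \<in> S \<Longrightarrow> Y \<subseteq> N \<Longrightarrow> Z \<subseteq> N \<Longrightarrow> Y \<union> Z \<in> S"
    and f_G: "\<And>Y. Y \<in> S \<Longrightarrow> f Y \<in> G"
    and f_ge: "\<And>Y. Y \<in> S \<Longrightarrow> Y \<subseteq> f Y"
    and f_le: "\<And>Y N. Y \<in> S \<Longrightarrow> N \<in> G \<Longrightarrow> Y \<subseteq> N \<Longrightarrow> f Y \<subseteq> N"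
    and f_B: "\<And>N. N \<in> G \<Longrightarrow> \<exists>Y\<in>S. Y \<subseteq> N \<and> f Y = N"
  shows "homotopy_equivalence_map (realisation S (\<subseteq>)) (realisation G (\<subseteq>)) (realise_map f)"
proof -
  define Ch where "Ch = poset_chains G (\<subseteq>)"
  define SCh where "SCh = poset_chains S (\<subseteq>)"
  obtain B where B: "\<And>N. N \<in> G \<Longrightarrow> B N \<in> S \<and> B N \<subseteq> N \<and> f (B N) = N"
    using f_B by metis
  \<comment> \<open>The choice \<open>B\<close> need not be monotone, but the union over the chain
    is monotone in the chain. In \<open>h\<close>, \<open>layers\<close> first passes to chains of
    chains, on which \<open>g\<close> acts as a vertex map.\<close>
  define g where "g = (\<lambda>c. \<Union> (B ` c))"
  define h where "h = realise_map g \<circ> layers"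
  have f_mono: "f Y \<subseteq> f Z" if "Y \<in> S" "Z \<in> S" "Y \<subseteq> Z" for Y Z
    using f_le[OF that(1) f_G[OF that(2)]] f_ge[OF that(2)] that(3) by blast
  have Ch_fin: "finite c \<and> c \<noteq> {}" if "c \<in> Ch" for c
    using that by (simp add: Ch_def poset_chains_def)
  have Ch_sub: "d \<in> Ch" if "c \<in> Ch" "d \<subseteq> c" "d \<noteq> {}" for c d
    using poset_chains_subset that unfolding Ch_def by metis
  have Ch_Union: "\<Union>c \<in> c" "c \<subseteq> G" if "c \<in> Ch" for c
    using that chain_Union[of c G] by (auto simp: Ch_def poset_chains_def)
  \<comment> \<open>The pieces \<open>B N\<close> are added one at a time. All lie in the largest
    member \<open>\<Union>c\<close> of the chain, which belongs to \<open>G\<close>, so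
    \<open>S_Un\<close> applies at each stage.\<close>
  have g_S: "g c \<in> S \<and> g c \<subseteq> \<Union>c" if c: "c \<in> Ch" for c
  proof -
    have "\<Union> (B ` d) \<in> S \<and> \<Union> (B ` d) \<subseteq> \<Union>c" if "finite d" "d \<noteq> {}" "d \<subseteq> c" for d
      using that
    proof (induction d rule: finite_ne_induct)
      case (singleton N)
      then show ?case using B[of N] Ch_Union(2)[OF c] by auto
    next
      case (insert N d)
      then have "N \<in> G" "N \<subseteq> \<Union>c"
        using Ch_Union(2)[OF c] by auto
      with insert B[of N] S_Un[of "\<Union>c" "B N" "\<Union> (B ` d)"] Ch_Union[OF c] show ?case
        by auto
    qed
    then show ?thesis
      using Ch_fin[OF c] by (simp add: g_def)
  qed
  have g_mono: "g c \<subseteq> g d" if "c \<subseteq> d" for c d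
    using that by (auto simp: g_def)
  have f_g: "f (g c) = \<Union>c" if c: "c \<in> Ch" for c
  proof
    have cG: "\<Union>c \<in> G"
      using Ch_Union[OF c] by blast
    show "f (g c) \<subseteq> \<Union>c"
      using g_S[OF c] cG f_le by blast
    \<comment> \<open>The largest member of the chain contributes its own generating face, whose
      closure is already all of \<open>\<Union>c\<close>.\<close>
    have "B (\<Union>c) \<subseteq> g c"
      using Ch_Union(1)[OF c] unfolding g_def by (rule UN_upper)
    then show "\<Union>c \<subseteq> f (g c)"
      using f_mono[of "B (\<Union>c)" "g c"] g_S[OF c] B[OF cG] by simp
  qed
  have f_chain: "f ` C \<in> Ch" if "C \<in> SCh" for C
    using that f_G f_mono unfolding SCh_def Ch_def by (rule poset_chains_image)
  \<comment> \<open>Each homotopy uses one bound on the chain \<open>K\<close> carrying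
    \<open>h t\<close>: its image under \<open>f\<close> stays in \<open>C\<close>, which handles
    \<open>f\<close> after \<open>h\<close>, and its union stays in \<open>g C\<close>, which
    handles \<open>h\<close> after \<open>f\<close>.\<close>
  have layers_carrier: "\<exists>K. K \<in> SCh \<and> f ` K \<subseteq> C \<and> \<Union>K \<subseteq> g C \<and> h t \<in> geom_simplex K"
    if C: "C \<in> Ch" and t: "t \<in> geom_simplex C" for C t
  proof -
    obtain K where K: "K \<in> poset_chains (Pow C - {{}}) (\<subseteq>)" and l: "layers t \<in> geom_simplex K"
      using layers_in_geom_simplex[OF conjunct1[OF Ch_fin[OF C]] t] .
    have sub: "K \<subseteq> Pow C - {{}}" and "finite K"
      using K by (auto simp: poset_chains_def)
    have KCh: "c \<in> Ch" "c \<subseteq> C" if "c \<in> K" for c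
      using sub that Ch_sub[OF C] by auto
    have "g ` K \<in> SCh"
      unfolding SCh_def by (rule poset_chains_image[OF K]) (use g_S g_mono Ch_sub[OF C] in auto)
    moreover have "f ` g ` K \<subseteq> C"
      using f_g Ch_Union(1) KCh by force
    moreover have "\<Union> (g ` K) \<subseteq> g C"
      using g_mono KCh by blast
    moreover have "h t \<in> geom_simplex (g ` K)"
      unfolding h_def using realise_map_in_geom_simplex[OF \<open>finite K\<close> l] by simp
    ultimately show ?thesis by blast
  qed
  have cf: "continuous_map (coherent_topology SCh) (coherent_topology Ch) (realise_map f)"
    by (rule continuous_map_realise_map) (use f_chain in \<open>auto simp: SCh_def poset_chains_def\<close>)
  have ch: "continuous_map (coherent_topology Ch) (coherent_topology SCh) h"
    unfolding h_def
  proof (rule continuous_map_compose)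
    show "continuous_map (coherent_topology Ch) (coherent_topology (poset_chains Ch (\<subseteq>))) layers"
      using Ch_fin Ch_sub by (intro continuous_map_layers) iprover+
    show "continuous_map (coherent_topology (poset_chains Ch (\<subseteq>))) (coherent_topology SCh) (realise_map g)"
    proof (rule continuous_map_realise_map)
      show "g ` K \<in> SCh" if "K \<in> poset_chains Ch (\<subseteq>)" for K
        using that g_S g_mono unfolding SCh_def by (intro poset_chains_image) auto
    qed (simp add: poset_chains_def)
  qed
  have cb: "continuous_map (coherent_topology SCh) (coherent_topology S) bary"
    unfolding SCh_def by (rule continuous_map_bary[OF S_fin])
  have cl: "continuous_map (coherent_topology S) (coherent_topology SCh) layers"
    unfolding SCh_def using S_fin S_sub by (intro continuous_map_layers) iprover+
  have "homotopic_with (\<lambda>_. True) (coherent_topology Ch) (coherent_topology Ch) (realise_map f \<circ> h) id"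
  proof (rule homotopic_coherent_linear)
    show "continuous_map (coherent_topology Ch) (coherent_topology Ch) (realise_map f \<circ> h)"
      using ch cf by (rule continuous_map_compose)
    show "\<exists>D\<in>Ch. finite D \<and> (realise_map f \<circ> h) ` geom_simplex C \<subseteq> geom_simplex D \<and>
        id ` geom_simplex C \<subseteq> geom_simplex D" if C: "C \<in> Ch" for C
    proof (intro bexI[OF _ C] conjI)
      show "finite C" using Ch_fin[OF C] by simp
      show "(realise_map f \<circ> h) ` geom_simplex C \<subseteq> geom_simplex C"
      proof clarify
        fix t assume t: "t \<in> geom_simplex C"
        obtain K where K: "K \<in> SCh" "f ` K \<subseteq> C" "h t \<in> geom_simplex K"
          using layers_carrier[OF C t] by iprover
        from K(1) have "finite K" by (simp add: SCh_def poset_chains_def)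
        from realise_map_in_geom_simplex[OF this K(3), of f]
        show "(realise_map f \<circ> h) t \<in> geom_simplex C"
          using geom_simplex_mono[OF K(2) \<open>finite C\<close>] by auto
      qed
    qed simp
  qed simp
  moreover have "homotopic_with (\<lambda>_. True) (coherent_topology SCh) (coherent_topology SCh) (h \<circ> realise_map f) id"
  proof -
    have chf: "continuous_map (coherent_topology SCh) (coherent_topology SCh) (h \<circ> realise_map f)"
      using cf ch by (rule continuous_map_compose)
    have "homotopic_with (\<lambda>_. True) (coherent_topology SCh) (coherent_topology S) (bary \<circ> (h \<circ> realise_map f)) bary"
    proof (rule homotopic_coherent_linear[OF continuous_map_compose[OF chf cb] cb])
      fix C assume C: "C \<in> SCh"
      then have C': "finite C" "C \<subseteq> S" "\<Union>C \<in> C"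
        using chain_Union[of C S] by (auto simp: SCh_def poset_chains_def)
      then have U: "\<Union>C \<in> S" by blast
      have fC: "f ` C \<in> Ch" by (rule f_chain[OF C])
      have "\<Union> (f ` C) \<subseteq> f (\<Union>C)"
        using f_mono U C' by blast
      then have gN: "g (f ` C) \<subseteq> f (\<Union>C)" "g (f ` C) \<in> S"
        using g_S[OF fC] by auto
      \<comment> \<open>Both pieces lie in \<open>f (\<Union>C)\<close>, a member of
        \<open>G\<close>, so their union is a face by \<open>S_Un\<close>. Its simplex contains the
        images of \<open>C\<close> under both maps to be joined.\<close>
      define D where "D = g (f ` C) \<union> \<Union>C"
      have D: "D \<in> S"
        unfolding D_def by (rule S_Un[OF f_G[OF U] gN(2) U gN(1) f_ge[OF U]])
      then have finD: "finite D" using S_fin by blast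
      have "bary (h (realise_map f s)) \<in> geom_simplex D" if s: "s \<in> geom_simplex C" for s
      proof -
        obtain K where K: "K \<in> SCh" "\<Union>K \<subseteq> g (f ` C)" "h (realise_map f s) \<in> geom_simplex K"
          using layers_carrier[OF fC realise_map_in_geom_simplex[OF C'(1) s]] by iprover
        have "bary (h (realise_map f s)) \<in> geom_simplex (\<Union>K)"
          by (rule bary_chain_in_geom_simplex[OF S_fin K(1)[unfolded SCh_def] K(3)])
        moreover have "\<Union>K \<subseteq> D"
          using K(2) by (auto simp: D_def)
        ultimately show ?thesis
          by (meson geom_simplex_mono finD subsetD)
      qed
      moreover have "bary s \<in> geom_simplex D" if s: "s \<in> geom_simplex C" for s
      proof -
        have "bary s \<in> geom_simplex (\<Union>C)"
          by (rule bary_chain_in_geom_simplex[OF S_fin C[unfolded SCh_def] s])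
        then show ?thesis
          using geom_simplex_mono[OF Un_upper2 finD[unfolded D_def]] unfolding D_def by (rule rev_subsetD)
      qed
      ultimately show "\<exists>D\<in>S. finite D \<and> (bary \<circ> (h \<circ> realise_map f)) ` geom_simplex C \<subseteq> geom_simplex D \<and>
          bary ` geom_simplex C \<subseteq> geom_simplex D"
        using D finD by (intro bexI[OF _ D] conjI image_subsetI) simp_all
    qed
    \<comment> \<open>\<open>layers\<close> carries the homotopy from the undivided complex back to
      the subdivision, where \<open>layers\<close> after \<open>bary\<close> is the
      identity.\<close>
    from homotopic_with_compose_continuous_map_left[OF this cl]
    have hom: "homotopic_with (\<lambda>_. True) (coherent_topology SCh) (coherent_topology SCh)
        (layers \<circ> (bary \<circ> (h \<circ> realise_map f))) (layers \<circ> bary)"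
      by simp
    have lb: "layers (bary s) = s" if "s \<in> coherent_carrier SCh" for s
      using layers_bary_id[OF S_fin] that by (simp add: SCh_def)
    have "(h \<circ> realise_map f) s \<in> coherent_carrier SCh" if "s \<in> coherent_carrier SCh" for s
      using continuous_map_funspace[OF chf] that by auto
    with lb show ?thesis
      by (intro homotopic_with_eq[OF hom]) simp_all
  qed
  ultimately show ?thesis
    using cf ch unfolding homotopy_equivalence_map_def realisation_eq_coherent SCh_def Ch_def by blast
qed

section \<open>Rank and saturation\<close>

locale fg_torsion_free_module = module scale
  for scale :: "'a::idom \<Rightarrow> 'm::ab_group_add \<Rightarrow> 'm" (infixr \<open>\<odot>\<close> 75) +
  assumes fin_gen: "fin_gen_module scale"
    and torsion_free: "torsion_free scale"
begin

text \<open>Gaussian elimination without division: the generator \<open>z\<close> is eliminated by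
  cross-multiplying with a nonzero coefficient \<open>c j\<close>. An indexed family is used because
  the new vectors \<open>w' i\<close> may coincide.\<close>

lemma ex_nontrivial_relation:
  assumes "finite Z" "finite I" "card Z < card I" "\<And>i. i \<in> I \<Longrightarrow> w i \<in> span Z"
  shows "\<exists>d. (\<exists>i\<in>I. d i \<noteq> 0) \<and> (\<Sum>i\<in>I. d i \<odot> w i) = 0"
  using assms
proof (induction Z arbitrary: I w rule: finite_induct)
  case empty
  then have "I \<noteq> {}" "\<And>i. i \<in> I \<Longrightarrow> w i = 0" by auto
  then show ?case
    by (intro exI[of _ "\<lambda>_. 1"]) auto
next
  case (insert z Z)
  have "\<exists>c. \<forall>i\<in>I. w i - c i \<odot> z \<in> span Z"
    using insert.prems(3) by (intro bchoice) (auto simp: span_breakdown_eq)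
  then obtain c where c: "\<And>i. i \<in> I \<Longrightarrow> w i - c i \<odot> z \<in> span Z" by blast
  show ?case
  proof (cases "\<forall>i\<in>I. c i = 0")
    case True
    then have "w i \<in> span Z" if "i \<in> I" for i
      using c[OF that] that by simp
    then show ?thesis
      using insert by simp
  next
    case False
    then obtain j where j: "j \<in> I" "c j \<noteq> 0" by blast
    define w' where "w' = (\<lambda>i. c j \<odot> w i - c i \<odot> w j)"
    have "w' i \<in> span Z" if "i \<in> I - {j}" for i
    proof -
      have "w' i = c j \<odot> (w i - c i \<odot> z) - c i \<odot> (w j - c j \<odot> z)"
        by (simp add: w'_def scale_right_diff_distrib mult.commute)
      also have "\<dots> \<in> span Z"
        by (rule span_diff[OF span_scale[OF c] span_scale[OF c]]) (use that j in auto)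
      finally show ?thesis .
    qed
    moreover have "card Z < card (I - {j})"
      using insert.prems insert.hyps j by simp
    ultimately obtain d where d: "\<exists>i\<in>I - {j}. d i \<noteq> 0" "(\<Sum>i\<in>I - {j}. d i \<odot> w' i) = 0"
      using insert.IH[of "I - {j}" w'] insert.prems by blast
    \<comment> \<open>Expanding the relation among the \<open>w' i\<close> collects all multiples of
      \<open>w j\<close> into one coefficient. The result is nontrivial because
      \<open>d i * c j\<close> is nonzero whenever \<open>d i\<close> is.\<close>
    define e where "e = (\<lambda>i. if i = j then - (\<Sum>i\<in>I - {j}. d i * c i) else d i * c j)"
    have "(\<Sum>i\<in>I. e i \<odot> w i) = e j \<odot> w j + (\<Sum>i\<in>I - {j}. e i \<odot> w i)"
      using insert.prems j by (simp add: sum.remove)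
    also have "\<dots> = (\<Sum>i\<in>I - {j}. d i \<odot> w' i)"
      by (simp add: e_def w'_def scale_sum_left scale_right_diff_distrib sum_subtractf)
    finally have "(\<Sum>i\<in>I. e i \<odot> w i) = 0"
      using d by simp
    moreover have "\<exists>i\<in>I. e i \<noteq> 0"
      using d(1) j by (auto simp: e_def)
    ultimately show ?thesis by blast
  qed
qed

text \<open>Multiplying each \<open>w\<close> by a denominator \<open>a w\<close> moves it into the
  span of \<open>Z\<close>. A nontrivial relation among these multiples is one among the
  \<open>w\<close> themselves, since the ring is a domain.\<close>

lemma independent_card_le:
  assumes "finite Z" "finite W" "independent W" "W \<subseteq> saturation scale (span Z)"
  shows "card W \<le> card Z"
proof (rule ccontr)
  assume "\<not> card W \<le> card Z"
  have "\<exists>a. \<forall>w\<in>W. a w \<noteq> 0 \<and> a w \<odot> w \<in> span Z"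
    using assms(4) by (intro bchoice) (auto simp: saturation_def)
  then obtain a where a: "\<And>w. w \<in> W \<Longrightarrow> a w \<noteq> 0 \<and> a w \<odot> w \<in> span Z" by blast
  obtain d where d: "\<exists>w\<in>W. d w \<noteq> 0" "(\<Sum>w\<in>W. d w \<odot> a w \<odot> w) = 0"
    using ex_nontrivial_relation[of Z W "\<lambda>w. a w \<odot> w"] assms a \<open>\<not> card W \<le> card Z\<close> by auto
  have "d w * a w = 0" if "w \<in> W" for w
    using independentD[OF assms(3,2) subset_refl _ that, of "\<lambda>w. d w * a w"] d(2) by simp
  with d(1) a show False by auto
qed

text \<open>Independence of \<open>Z\<close> forces \<open>y\<close> to occur in the relation with a
  nonzero coefficient; that coefficient is the denominator witnessing membership in the
  saturation.\<close>

lemma dependent_insert_imp_saturation: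
  assumes "independent Z" "dependent (insert y Z)"
  shows "y \<in> saturation scale (span Z)"
proof -
  obtain t u v where t: "finite t" "t \<subseteq> insert y Z" "(\<Sum>v\<in>t. u v \<odot> v) = 0" "v \<in> t" "u v \<noteq> 0"
    using assms(2) by (auto simp: dependent_explicit)
  have y: "y \<in> t"
    using t assms(1) by (metis independentD subset_insert)
  have "(\<Sum>v\<in>t. u v \<odot> v) = u y \<odot> y + (\<Sum>v\<in>t - {y}. u v \<odot> v)"
    using t(1) y by (rule sum.remove)
  then have "u y \<odot> y = - (\<Sum>v\<in>t - {y}. u v \<odot> v)"
    using t(3) by (simp add: eq_neg_iff_add_eq_0)
  also have "\<dots> \<in> span Z"
    using t(2) by (intro span_neg span_sum span_scale span_base) auto
  finally have sp: "u y \<odot> y \<in> span Z" .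
  have "u y \<noteq> 0"
  proof
    assume "u y = 0"
    then have "(\<Sum>v\<in>t - {y}. u v \<odot> v) = 0" "v \<in> t - {y}"
      using t \<open>(\<Sum>v\<in>t. u v \<odot> v) = u y \<odot> y + _\<close> by auto
    then show False
      using independentD[OF assms(1), of "t - {y}" u v] t by auto
  qed
  with sp show ?thesis by (auto simp: saturation_def)
qed

lemma pure_submodule_saturation:
  assumes "subspace P"
  shows "pure_submodule scale (saturation scale P)"
  unfolding pure_submodule_def
proof (intro conjI allI impI)
  show "subspace (saturation scale P)"
  proof (rule subspaceI)
    show "0 \<in> saturation scale P"
      using subspace_0[OF assms] by (auto simp: saturation_def intro!: exI[of _ 1])
  next
    fix x y assume "x \<in> saturation scale P" "y \<in> saturation scale P"
    then obtain a b where ab: "a \<noteq> 0" "a \<odot> x \<in> P" "b \<noteq> 0" "b \<odot> y \<in> P"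
      by (auto simp: saturation_def)
    have "(a * b) \<odot> (x + y) = b \<odot> a \<odot> x + a \<odot> b \<odot> y"
      by (simp add: scale_right_distrib mult.commute)
    also have "\<dots> \<in> P"
      by (rule subspace_add[OF assms subspace_scale[OF assms ab(2)] subspace_scale[OF assms ab(4)]])
    finally show "x + y \<in> saturation scale P"
      using ab by (auto simp: saturation_def intro!: exI[of _ "a * b"])
  next
    fix c x assume "x \<in> saturation scale P"
    then obtain a where a: "a \<noteq> 0" "a \<odot> x \<in> P"
      by (auto simp: saturation_def)
    have "a \<odot> c \<odot> x = c \<odot> a \<odot> x"
      by (simp add: mult.commute)
    then have "a \<odot> c \<odot> x \<in> P"
      using a assms subspace_scale by metis
    with a show "c \<odot> x \<in> saturation scale P"
      by (auto simp: saturation_def)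
  qed
next
  fix a m assume "a \<noteq> 0" "a \<odot> m \<in> saturation scale P"
  then obtain b where "b \<noteq> 0" "b \<odot> a \<odot> m \<in> P"
    by (auto simp: saturation_def)
  with \<open>a \<noteq> 0\<close> show "m \<in> saturation scale P"
    by (auto simp: saturation_def intro!: exI[of _ "b * a"])
qed

lemma pure_submodule_AR: "pure_submodule scale (AR scale Y)"
  unfolding AR_def by (rule pure_submodule_saturation[OF subspace_span])

lemma subset_AR: "Y \<subseteq> AR scale Y"
proof
  fix y assume "y \<in> Y"
  then have "1 \<odot> y \<in> span Y"
    by (simp add: span_base)
  then show "y \<in> AR scale Y"
    unfolding AR_def saturation_def using one_neq_zero by blast
qed

text \<open>Together with \<open>pure_submodule_AR\<close> and \<open>subset_AR\<close> this makes
  \<open>AR\<close> the closure operator whose closed sets are the pure submodules.\<close>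

lemma AR_subset:
  assumes "pure_submodule scale N" "Y \<subseteq> N"
  shows "AR scale Y \<subseteq> N"
proof -
  have "span Y \<subseteq> N"
    using assms span_minimal by (auto simp: pure_submodule_def)
  with assms show ?thesis
    by (auto simp: AR_def saturation_def pure_submodule_def)
qed

text \<open>The number of module generators bounds every independent set, so the \<open>Max\<close>
  defining the rank is attained.\<close>

lemma finite_independent_cards:
  "finite {card Z | Z. Z \<subseteq> Y \<and> finite Z \<and> independent Z}"
proof -
  obtain S where S: "finite S" "span S = UNIV"
    using fin_gen by (auto simp: fin_gen_module_def)
  then have "saturation scale (span S) = UNIV"
    by (auto simp: saturation_def intro!: exI[of _ 1])
  then have "card Z \<le> card S" if "finite Z" "independent Z" for Z
    using independent_card_le[OF S(1) that] by simp
  then show ?thesis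
    by (rule_tac finite_subset[OF _ finite_atMost[of "card S"]]) auto
qed

lemma card_le_mod_rank: "Z \<subseteq> Y \<Longrightarrow> finite Z \<Longrightarrow> independent Z \<Longrightarrow> card Z \<le> mod_rank scale Y"
  unfolding mod_rank_def by (rule Max_ge[OF finite_independent_cards]) auto

text \<open>Take an independent subset of largest size: by maximality, any further element of
  \<open>Y\<close> creates a relation and so lies in the saturated span.\<close>

lemma ex_basis:
  obtains Z where "Z \<subseteq> Y" "finite Z" "independent Z" "card Z = mod_rank scale Y" "Y \<subseteq> AR scale Z"
proof -
  have "{card Z | Z. Z \<subseteq> Y \<and> finite Z \<and> independent Z} \<noteq> {}"
    using independent_empty by blast
  from Max_in[OF finite_independent_cards this]
  obtain Z where Z: "Z \<subseteq> Y" "finite Z" "independent Z" "card Z = mod_rank scale Y"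
    by (auto simp: mod_rank_def)
  have "y \<in> AR scale Z" if "y \<in> Y" for y
  proof (cases "y \<in> Z")
    case True
    then show ?thesis using subset_AR by blast
  next
    case False
    have "dependent (insert y Z)"
      using card_le_mod_rank[of "insert y Z" Y] Z False that by auto
    then show ?thesis
      unfolding AR_def by (rule dependent_insert_imp_saturation[OF Z(3)])
  qed
  with Z that show ?thesis by blast
qed

lemma mod_rank_mono:
  assumes "Y \<subseteq> Y'"
  shows "mod_rank scale Y \<le> mod_rank scale Y'"
proof -
  obtain Z where "Z \<subseteq> Y" "finite Z" "independent Z" "card Z = mod_rank scale Y" "Y \<subseteq> AR scale Z"
    by (rule ex_basis)
  with assms show ?thesis
    using card_le_mod_rank[of Z Y'] by simp
qed

text \<open>An element outside \<open>N\<close> lies outside the saturated span of a basis of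
  \<open>Y\<close>, so adding it keeps the basis independent and gains one in rank.\<close>

lemma mod_rank_less:
  assumes N: "pure_submodule scale N" "N \<noteq> UNIV" and "Y \<subseteq> N"
  shows "mod_rank scale Y < mod_rank scale UNIV"
proof -
  obtain Z where Z: "Z \<subseteq> Y" "finite Z" "independent Z" "card Z = mod_rank scale Y" "Y \<subseteq> AR scale Z"
    by (rule ex_basis)
  obtain m where m: "m \<notin> N"
    using N by blast
  have "AR scale Z \<subseteq> N"
    using AR_subset[OF N(1)] Z(1) assms(3) by auto
  with m have "independent (insert m Z)"
    using dependent_insert_imp_saturation[OF Z(3)] by (auto simp: AR_def)
  moreover have "m \<notin> Z"
    using m Z assms(3) by blast
  ultimately show ?thesis
    using card_le_mod_rank[of "insert m Z" UNIV] Z by simp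
qed

text \<open>A basis of \<open>Y\<close> also has all of the module as saturated span, so it is at
  least as large as any independent set.\<close>

lemma mod_rank_eq_UNIV:
  assumes "AR scale Y = UNIV"
  shows "mod_rank scale Y = mod_rank scale UNIV"
proof (rule antisym)
  obtain Z where "Z \<subseteq> Y" and Z: "finite Z" and "independent Z"
      and card_Z: "card Z = mod_rank scale Y" and Y: "Y \<subseteq> AR scale Z"
    by (rule ex_basis)
  obtain W :: "'m set" where "W \<subseteq> UNIV" and W: "finite W" "independent W"
      and card_W: "card W = mod_rank scale UNIV" and "UNIV \<subseteq> AR scale W"
    by (rule ex_basis)
  have "AR scale Z = UNIV"
    using AR_subset[OF pure_submodule_AR Y] assms by auto
  then show "mod_rank scale UNIV \<le> mod_rank scale Y"
    using independent_card_le[OF Z W] card_Z card_W by (simp add: AR_def)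
qed (simp add: mod_rank_mono)

section \<open>The saturation map between the two posets\<close>

lemma Sstar_if_subset_Gstar:
  assumes "N \<in> Gstar scale" "Y \<subseteq> N" "finite Y" "Y \<noteq> {}" "0 \<notin> Y"
  shows "Y \<in> Sstar scale"
  using assms mod_rank_less[of N Y] by (simp add: Gstar_def Sstar_def)

lemma AR_in_Gstar:
  assumes "Y \<in> Sstar scale"
  shows "AR scale Y \<in> Gstar scale"
proof -
  have "AR scale Y \<noteq> {0}"
    using assms subset_AR[of Y] by (auto simp: Sstar_def)
  moreover have "AR scale Y \<noteq> UNIV"
    using assms mod_rank_eq_UNIV[of Y] by (auto simp: Sstar_def)
  ultimately show ?thesis
    using pure_submodule_AR by (simp add: Gstar_def)
qed

lemma AR_surj_Gstar:
  assumes N: "N \<in> Gstar scale"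
  shows "\<exists>Y\<in>Sstar scale. Y \<subseteq> N \<and> AR scale Y = N"
proof -
  have pure: "pure_submodule scale N" and "N \<noteq> {0}"
    using N by (simp_all add: Gstar_def)
  obtain Z where Z: "Z \<subseteq> N" "finite Z" "independent Z" "card Z = mod_rank scale N" "N \<subseteq> AR scale Z"
    by (rule ex_basis)
  have eq: "AR scale Z = N"
    using AR_subset[OF pure Z(1)] Z(5) by (rule subset_antisym)
  \<comment> \<open>Torsion-freeness says that the zero submodule is saturated; hence a basis of the
    nonzero module \<open>N\<close> is nonempty and qualifies as a simplex.\<close>
  have "AR scale {} = {0}"
    using torsion_free by (auto simp: AR_def saturation_def torsion_free_def intro: exI[of _ 1])
  with eq \<open>N \<noteq> {0}\<close> have "Z \<noteq> {}" by auto
  moreover have "0 \<notin> Z"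
    using Z(3) dependent_zero by blast
  ultimately show ?thesis
    using Sstar_if_subset_Gstar[OF N Z(1,2)] Z(1) eq by blast
qed

end

theorem theorem4p2:
  fixes sc :: "'a::idom \<Rightarrow> 'm::ab_group_add \<Rightarrow> 'm"
  assumes "module sc"
    and "noetherian_ring TYPE('a)"
    and "fin_gen_module sc"
    and "torsion_free sc"
    and "mod_rank sc UNIV \<ge> 2"
  shows "homotopy_equivalence_map
           (realisation (Sstar sc) (\<subseteq>)) (realisation (Gstar sc) (\<subseteq>))
           (realise_map (AR sc))"
proof -
  interpret fg_torsion_free_module sc
    using assms by (simp add: fg_torsion_free_module_def fg_torsion_free_module_axioms_def)
  show ?thesis
  proof (rule homotopy_equivalence_realise_map)
    show "finite Y \<and> Y \<noteq> {}" if "Y \<in> Sstar sc" for Y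
      using that by (simp add: Sstar_def)
    show "Z \<in> Sstar sc" if "Y \<in> Sstar sc" "Z \<subseteq> Y" "Z \<noteq> {}" for Y Z
      using that mod_rank_mono[OF that(2)] finite_subset[OF that(2)] by (auto simp: Sstar_def)
    \<comment> \<open>The ranks of \<open>Y\<close> and \<open>Z\<close> alone do not keep the rank
      of the union below the maximum; containment in the proper pure submodule \<open>N\<close>
      does.\<close>
    show "Y \<union> Z \<in> Sstar sc"
      if "N \<in> Gstar sc" "Y \<in> Sstar sc" "Z \<in> Sstar sc" "Y \<subseteq> N" "Z \<subseteq> N" for N Y Z
      by (rule Sstar_if_subset_Gstar[OF that(1)]) (use that in \<open>auto simp: Sstar_def\<close>)
    show "AR sc Y \<subseteq> N" if "Y \<in> Sstar sc" "N \<in> Gstar sc" "Y \<subseteq> N" for Y N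
      by (rule AR_subset) (use that in \<open>simp_all add: Gstar_def\<close>)
  qed (simp_all add: AR_in_Gstar subset_AR AR_surj_Gstar)
qed

end
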